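(* Let $P=\mathbb{Z}[x_1,\dots,x_n]$, let $I\subseteq P$ be an ideal such that $P/I$ is a finite $\mathbb{Z}$-algebra, let $\sigma$ be a term ordering on $\mathbb{T}^n$, and let $L=\{m\in\mathrm{LM}_\sigma(I)\mid\mathrm{LC}_\sigma(m)=1\}$ be the set of all monic leading monomials of $I$. Then the residue classes of the terms in $\mathcal{O}_\sigma=\mathbb{T}^n\setminus L$ form a generating set of the $\mathbb{Z}$-module $P/I$.
   Context: $\mathbb{T}^n$ is the monoid of terms (power products) in $x_1,\dots,x_n$. For $f\in P\setminus\{0\}$, $\mathrm{LT}_\sigma(f)$ is the leading term, $\mathrm{LC}_\sigma(f)\in\mathbb{Z}$ the leading coefficient, and $\mathrm{LM}_\sigma(f)=\mathrm{LC}_\sigma(f)\,\mathrm{LT}_\sigma(f)$ the leading monomial; $\mathrm{LM}_\sigma(I)=\{\mathrm{LM}_\sigma(f)\mid f\in I\setminus\{0\}\}$. A finite $\mathbb{Z}$-algebra is a $\mathbb{Z}$-algebra which is a finitely generated $\mathbb{Z}$-module. *)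

theory Defs
  imports "HOL-Algebra.Algebra" "HOL-Library.Poly_Mapping"
begin

text \<open>An exponent vector \<open>nat \<Rightarrow>\<^sub>0 nat\<close> encodes the term
  \<open>x\<^sub>1^(t 1) \<cdots> x\<^sub>n^(t n)\<close>; multiplication of terms is addition of exponent vectors and the
  term \<open>1\<close> is the vector \<open>0\<close>.\<close>

definition exponents :: "nat \<Rightarrow> (nat \<Rightarrow>\<^sub>0 nat) set" where
  "exponents n = {t. Poly_Mapping.keys t \<subseteq> {1..n}}"

type_synonym zpoly = "(nat \<Rightarrow>\<^sub>0 nat) \<Rightarrow>\<^sub>0 int"

text \<open>\<open>\<int>[x\<^sub>1, \<dots>, x\<^sub>n]\<close>, as a subring of the polynomials over \<open>\<int>\<close> in countably many
  indeterminates. The multiplication on the type is the convolution product.\<close>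

definition zpoly_ring :: "nat \<Rightarrow> zpoly ring" where
  "zpoly_ring n =
    \<lparr> carrier = {f. Poly_Mapping.keys f \<subseteq> exponents n},
      monoid.mult = (*), one = 1, ring.zero = 0, add = (+) \<rparr>"

text \<open>The monoid of terms, as a subset of the polynomial ring.\<close>

definition term_poly :: "(nat \<Rightarrow>\<^sub>0 nat) \<Rightarrow> zpoly" where
  "term_poly t = Poly_Mapping.single t 1"

definition terms :: "nat \<Rightarrow> zpoly set" where
  "terms n = term_poly ` exponents n"

text \<open>\<open>(s, t) \<in> \<sigma>\<close> means that \<open>s\<close> is at most \<open>t\<close>. That \<open>\<sigma>\<close> is a well-ordering is a
  consequence (Dickson's lemma), not part of the definition.\<close>

definition term_ordering :: "nat \<Rightarrow> (nat \<Rightarrow>\<^sub>0 nat) rel \<Rightarrow> bool" where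
  "term_ordering n \<sigma> \<longleftrightarrow>
     linear_order_on (exponents n) \<sigma> \<and>
     (\<forall>t\<in>exponents n. (0, t) \<in> \<sigma>) \<and>
     (\<forall>s t. \<forall>u\<in>exponents n. (s, t) \<in> \<sigma> \<longrightarrow> (s + u, t + u) \<in> \<sigma>)"

text \<open>Leading terms, coefficients and monomials are only meaningful for \<open>f \<noteq> 0\<close>.\<close>

definition LT :: "(nat \<Rightarrow>\<^sub>0 nat) rel \<Rightarrow> zpoly \<Rightarrow> (nat \<Rightarrow>\<^sub>0 nat)" where
  "LT \<sigma> f = (THE t. t \<in> Poly_Mapping.keys f \<and> (\<forall>s\<in>Poly_Mapping.keys f. (s, t) \<in> \<sigma>))"

definition LC :: "(nat \<Rightarrow>\<^sub>0 nat) rel \<Rightarrow> zpoly \<Rightarrow> int" where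
  "LC \<sigma> f = Poly_Mapping.lookup f (LT \<sigma> f)"

definition LM :: "(nat \<Rightarrow>\<^sub>0 nat) rel \<Rightarrow> zpoly \<Rightarrow> zpoly" where
  "LM \<sigma> f = Poly_Mapping.single (LT \<sigma> f) (LC \<sigma> f)"

definition LM_set :: "(nat \<Rightarrow>\<^sub>0 nat) rel \<Rightarrow> zpoly set \<Rightarrow> zpoly set" where
  "LM_set \<sigma> I = LM \<sigma> ` (I - {0})"

text \<open>\<open>S\<close> generates the additive group of \<open>R\<close> as a \<open>\<int>\<close>-module: every element is a finite
  \<open>\<int>\<close>-linear combination of elements of \<open>S\<close>.\<close>

definition int_generating_set :: "('a, 'b) ring_scheme \<Rightarrow> 'a set \<Rightarrow> bool" where
  "int_generating_set R S \<longleftrightarrow>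
     S \<subseteq> carrier R \<and>
     (\<forall>x\<in>carrier R. \<exists>T. \<exists>c :: 'a \<Rightarrow> int. finite T \<and> T \<subseteq> S \<and>
        x = (\<Oplus>\<^bsub>R\<^esub>s\<in>T. add_pow R (c s) s))"

text \<open>Every ring is a \<open>\<int>\<close>-algebra in exactly one way.\<close>

definition finite_int_algebra :: "('a, 'b) ring_scheme \<Rightarrow> bool" where
  "finite_int_algebra R \<longleftrightarrow> ring R \<and> (\<exists>S. finite S \<and> int_generating_set R S)"

lemma zero_in_exponents [simp]: "0 \<in> exponents n"
  by (simp add: exponents_def)

lemma add_in_exponents: "s \<in> exponents n \<Longrightarrow> t \<in> exponents n \<Longrightarrow> s + t \<in> exponents n"
  using Poly_Mapping.keys_add[of s t] by (auto simp: exponents_def)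

lemma zpoly_ring_cring: "cring (zpoly_ring n)"
proof (rule cringI)
  show "abelian_group (zpoly_ring n)"
  proof (rule abelian_groupI)
    fix f assume "f \<in> carrier (zpoly_ring n)"
    then have "- f \<in> carrier (zpoly_ring n)" and "- f + f = 0"
      by (simp_all add: zpoly_ring_def)
    then show "\<exists>g\<in>carrier (zpoly_ring n). g \<oplus>\<^bsub>zpoly_ring n\<^esub> f = \<zero>\<^bsub>zpoly_ring n\<^esub>"
      by (intro bexI[of _ "- f"]) (simp_all add: zpoly_ring_def)
  next
    fix f g assume "f \<in> carrier (zpoly_ring n)" "g \<in> carrier (zpoly_ring n)"
    then show "f \<oplus>\<^bsub>zpoly_ring n\<^esub> g \<in> carrier (zpoly_ring n)"
      using Poly_Mapping.keys_add[of f g] by (auto simp: zpoly_ring_def)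
  qed (simp_all add: zpoly_ring_def algebra_simps)
next
  show "Group.comm_monoid (zpoly_ring n)"
  proof (rule comm_monoidI)
    fix f g assume "f \<in> carrier (zpoly_ring n)" "g \<in> carrier (zpoly_ring n)"
    then show "f \<otimes>\<^bsub>zpoly_ring n\<^esub> g \<in> carrier (zpoly_ring n)"
      using Poly_Mapping.keys_mult[of f g] add_in_exponents
      by (fastforce simp: zpoly_ring_def)
  qed (simp_all add: zpoly_ring_def algebra_simps)
qed (simp add: zpoly_ring_def algebra_simps)

end

theory Submission
  imports Defs
begin

text \<open>A term ordering refines divisibility of terms, so Dickson's lemma makes it well-founded
  (\<open>wf_strict_term_ordering\<close>). If a term \<open>t\<close> is the monic leading monomial of some \<open>f \<in> I\<close>, then
  \<open>t - f\<close> is congruent to \<open>t\<close> modulo \<open>I\<close> and involves only smaller terms; it is essential here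
  that the leading coefficient is \<open>1\<close>, since division by integers is impossible. Well-founded
  induction on \<open>t\<close> therefore rewrites every term, and hence every polynomial, modulo \<open>I\<close> into an
  integer combination of terms outside \<open>L\<close> (\<open>normal_form_mod_ideal\<close>).

  Linear combinations in the quotient are indexed by residue classes and not by terms, so two
  terms in the same class would have to share a coefficient. This never happens outside \<open>L\<close>: for
  congruent terms \<open>s\<close> and \<open>t\<close> with \<open>s\<close> smaller than \<open>t\<close>, the binomial \<open>t - s\<close> lies in \<open>I\<close> and its
  leading monomial \<open>t\<close> is monic.\<close>


section \<open>Well-foundedness of term orderings\<close>

lemma nat_seq_incseq_subseq:
  fixes f :: "nat \<Rightarrow> nat"
  shows "\<exists>\<phi>. strict_mono \<phi> \<and> incseq (\<lambda>k. f (\<phi> k))"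
proof -
  obtain \<psi> where psi: "strict_mono \<psi>" "monoseq (\<lambda>k. f (\<psi> k))"
    using seq_monosub by blast
  show ?thesis
  proof (cases "incseq (\<lambda>k. f (\<psi> k))")
    case True
    with psi show ?thesis by blast
  next
    case False
    with psi have dec: "decseq (\<lambda>k. f (\<psi> k))"
      by (simp add: monoseq_iff)
    \<comment> \<open>A decreasing sequence is constant from the point on where it attains its minimum.\<close>
    obtain N where N: "\<And>k. f (\<psi> N) \<le> f (\<psi> k)"
      using ex_has_least_nat[of "\<lambda>_. True" 0 "\<lambda>k. f (\<psi> k)"] by auto
    have "f (\<psi> (N + k)) = f (\<psi> N)" for k
      using N decseqD[OF dec, of N "N + k"] by (intro antisym) auto
    then have "incseq (\<lambda>k. f (\<psi> (N + k)))"
      by (simp add: incseq_def)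
    moreover have "strict_mono (\<lambda>k. \<psi> (N + k))"
      using psi(1) by (simp add: strict_mono_def)
    ultimately show ?thesis by blast
  qed
qed

text \<open>Dickson's lemma in its sequential form: one coordinate after the other is made increasing,
  and passing to a further subsequence preserves the coordinates already treated.\<close>

lemma dickson_subseq:
  fixes f :: "nat \<Rightarrow> 'a \<Rightarrow> nat"
  assumes "finite A"
  shows "\<exists>\<phi>. strict_mono \<phi> \<and> (\<forall>i\<in>A. incseq (\<lambda>k. f (\<phi> k) i))"
  using assms
proof (induction A)
  case empty
  show ?case using strict_mono_id by blast
next
  case (insert a A)
  then obtain \<phi> where phi: "strict_mono \<phi>" "\<forall>i\<in>A. incseq (\<lambda>k. f (\<phi> k) i)"
    by blast
  obtain \<psi> where psi: "strict_mono \<psi>" "incseq (\<lambda>k. f (\<phi> (\<psi> k)) a)"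
    using nat_seq_incseq_subseq[of "\<lambda>k. f (\<phi> k) a"] by blast
  have "\<forall>i\<in>insert a A. incseq (\<lambda>k. f ((\<phi> \<circ> \<psi>) k) i)"
    using phi(2) psi strict_mono_mono[OF psi(1)] by (auto simp: incseq_def mono_def)
  with strict_mono_o[OF phi(1) psi(1)] show ?case by blast
qed

lemma exponents_lookup_eq_0: "t \<in> exponents n \<Longrightarrow> i \<notin> {1..n} \<Longrightarrow> Poly_Mapping.lookup t i = 0"
  by (auto simp: exponents_def in_keys_iff)

lemma term_ordering_linear:
  assumes "term_ordering n \<sigma>"
  shows "\<sigma> \<subseteq> exponents n \<times> exponents n" "refl_on (exponents n) \<sigma>" "trans \<sigma>" "antisym \<sigma>"
    "total_on (exponents n) \<sigma>"
  using assms by (auto simp: term_ordering_def order_on_defs)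

text \<open>Compatibility with multiplication turns \<open>1 \<le> t / s\<close> into \<open>s \<le> t\<close>.\<close>

lemma term_ordering_divides:
  assumes "term_ordering n \<sigma>" "s \<in> exponents n" "t \<in> exponents n"
    and le: "\<And>i. i \<in> {1..n} \<Longrightarrow> Poly_Mapping.lookup s i \<le> Poly_Mapping.lookup t i"
  shows "(s, t) \<in> \<sigma>"
proof -
  have le': "Poly_Mapping.lookup s i \<le> Poly_Mapping.lookup t i" for i
    using le exponents_lookup_eq_0[OF assms(2)] by (cases "i \<in> {1..n}") auto
  have "t - s \<in> exponents n"
    using assms(3) by (auto simp: exponents_def in_keys_iff lookup_minus)
  then have "(0, t - s) \<in> \<sigma>"
    using assms(1) by (simp add: term_ordering_def)
  with assms(1,2) have "(0 + s, (t - s) + s) \<in> \<sigma>"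
    unfolding term_ordering_def by blast
  moreover have "(t - s) + s = t"
    by (rule poly_mapping_eqI) (simp add: lookup_add lookup_minus le')
  ultimately show ?thesis by simp
qed

text \<open>In an infinite strictly descending chain, Dickson's lemma yields a term that divides a later
  one and so is not greater than it.\<close>

lemma wf_strict_term_ordering:
  assumes "term_ordering n \<sigma>"
  shows "wf (\<sigma> - Id)"
  unfolding wf_iff_no_infinite_down_chain
proof
  note lin = term_ordering_linear[OF assms]
  assume "\<exists>f. \<forall>i. (f (Suc i), f i) \<in> \<sigma> - Id"
  then obtain f where f: "\<And>i. (f (Suc i), f i) \<in> \<sigma> - Id" by blast
  have strict: "trans (\<sigma> - Id)"
    using lin(3,4) by (rule trans_diff_Id)
  have desc: "(f j, f i) \<in> \<sigma> - Id" if "i < j" for i j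
    using that
  proof (induction j)
    case (Suc j)
    show ?case
    proof (cases "i = j")
      case True
      with f show ?thesis by simp
    next
      case False
      with Suc have "(f j, f i) \<in> \<sigma> - Id" by simp
      with f show ?thesis by (rule transD[OF strict])
    qed
  qed simp
  obtain \<phi> where phi: "strict_mono \<phi>"
    "\<forall>i\<in>{1..n}. incseq (\<lambda>k. Poly_Mapping.lookup (f (\<phi> k)) i)"
    using dickson_subseq[of "{1..n}" "\<lambda>k. Poly_Mapping.lookup (f k)"] by blast
  have "(f (\<phi> 0), f (\<phi> 1)) \<in> \<sigma>"
  proof (rule term_ordering_divides[OF assms])
    show "f (\<phi> 0) \<in> exponents n" "f (\<phi> 1) \<in> exponents n"
      using f lin(1) by blast+
    show "Poly_Mapping.lookup (f (\<phi> 0)) i \<le> Poly_Mapping.lookup (f (\<phi> 1)) i"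
      if "i \<in> {1..n}" for i
      using phi(2) that by (auto simp: incseq_def)
  qed
  moreover have "(f (\<phi> 1), f (\<phi> 0)) \<in> \<sigma> - Id"
    using phi(1) by (intro desc) (simp add: strict_mono_def)
  ultimately show False
    using lin(4) by (auto dest: antisymD)
qed


section \<open>Leading terms\<close>

lemma zpoly_ring_simps:
  "f \<in> carrier (zpoly_ring n) \<longleftrightarrow> Poly_Mapping.keys f \<subseteq> exponents n"
  "add (zpoly_ring n) = (+)" "\<zero>\<^bsub>zpoly_ring n\<^esub> = 0"
  by (simp_all add: zpoly_ring_def)

lemma LT_eqI:
  assumes "antisym \<sigma>" "t \<in> Poly_Mapping.keys f" "\<And>s. s \<in> Poly_Mapping.keys f \<Longrightarrow> (s, t) \<in> \<sigma>"
  shows "LT \<sigma> f = t"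
  unfolding LT_def using assms by (intro the_equality) (auto dest: antisymD)

lemma LT_greatest:
  assumes "term_ordering n \<sigma>" "f \<in> carrier (zpoly_ring n)" "f \<noteq> 0"
    and "s \<in> Poly_Mapping.keys f"
  shows "(s, LT \<sigma> f) \<in> \<sigma>"
proof -
  note lin = term_ordering_linear[OF assms(1)]
  have greatest: "\<exists>t\<in>A. \<forall>s\<in>A. (s, t) \<in> \<sigma>" if "finite A" "A \<noteq> {}" "A \<subseteq> exponents n" for A
    using that
  proof (induction A rule: finite_ne_induct)
    case (singleton a)
    then show ?case using lin(2) by (auto simp: refl_on_def)
  next
    case (insert a A)
    then obtain t where t: "t \<in> A" "\<forall>s\<in>A. (s, t) \<in> \<sigma>" by auto
    have a: "(a, a) \<in> \<sigma>"
      using lin(2) insert.prems by (auto simp: refl_on_def)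
    show ?case
    proof (cases "(a, t) \<in> \<sigma>")
      case True
      with t show ?thesis by auto
    next
      case False
      then have "(t, a) \<in> \<sigma>"
        using lin(5) a t(1) insert.prems unfolding total_on_def by (metis insert_subset subsetD)
      with t a show ?thesis
        by (metis insert_iff transD[OF lin(3)])
    qed
  qed
  obtain t where t: "t \<in> Poly_Mapping.keys f" "\<forall>s\<in>Poly_Mapping.keys f. (s, t) \<in> \<sigma>"
    using greatest[of "Poly_Mapping.keys f"] assms(2,3) by (auto simp: zpoly_ring_simps)
  then have "LT \<sigma> f = t"
    by (intro LT_eqI lin(4)) auto
  with t assms(4) show ?thesis by auto
qed

lemma LC_single:
  assumes "c \<noteq> 0" "antisym \<sigma>" "(t, t) \<in> \<sigma>"
  shows "LC \<sigma> (Poly_Mapping.single t c) = c"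
proof -
  have "LT \<sigma> (Poly_Mapping.single t c) = t"
    using assms by (intro LT_eqI) auto
  then show ?thesis by (simp add: LC_def)
qed

text \<open>\<open>L\<close> consists of polynomials \<open>LM f\<close> and its condition speaks of their leading coefficients;
  for a term this amounts to a condition on the exponent vector and the coefficient of \<open>f\<close>
  itself.\<close>

lemma monic_leading_monomial_iff:
  assumes \<sigma>: "term_ordering n \<sigma>" and "I \<subseteq> carrier (zpoly_ring n)" and t: "t \<in> exponents n"
  shows "term_poly t \<in> {m \<in> LM_set \<sigma> I. LC \<sigma> m = 1} \<longleftrightarrow>
    (\<exists>f\<in>I - {0}. LT \<sigma> f = t \<and> LC \<sigma> f = 1)"
proof -
  have "(t, t) \<in> \<sigma>"
    using term_ordering_linear(2)[OF \<sigma>] t by (auto simp: refl_on_def)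
  then have "LC \<sigma> (term_poly t) = 1"
    using term_ordering_linear(4)[OF \<sigma>] by (simp add: term_poly_def LC_single)
  moreover have "Poly_Mapping.single s c = Poly_Mapping.single t 1 \<longleftrightarrow> s = t \<and> c = 1" for s and c :: int
    by (metis keys_single lookup_single_eq singleton_inject zero_neq_one empty_not_insert)
  ultimately show ?thesis
    by (auto simp: LM_set_def LM_def term_poly_def image_iff eq_commute[of "Poly_Mapping.single t 1"])
qed


section \<open>Reduction modulo the ideal\<close>

lemma zpoly_ring_a_inv:
  "f \<in> carrier (zpoly_ring n) \<Longrightarrow> \<ominus>\<^bsub>zpoly_ring n\<^esub> f = - f"
proof -
  interpret P: cring "zpoly_ring n" by (rule zpoly_ring_cring)
  assume "f \<in> carrier (zpoly_ring n)"
  then show ?thesis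
    by (intro P.minus_equality) (simp_all add: zpoly_ring_simps)
qed

lemma zpoly_ring_a_minus:
  "g \<in> carrier (zpoly_ring n) \<Longrightarrow> f \<ominus>\<^bsub>zpoly_ring n\<^esub> g = f - g"
  by (simp add: a_minus_def zpoly_ring_a_inv) (simp add: zpoly_ring_simps)

lemma ideal_diff:
  assumes "ideal I (zpoly_ring n)" "f \<in> I" "g \<in> I"
  shows "f - g \<in> I"
proof -
  interpret ideal I "zpoly_ring n" by fact
  show ?thesis
    using assms(2,3) zpoly_ring_a_inv[OF Icarr]
      additive_subgroup.a_closed[OF is_additive_subgroup, of f "- g"]
      additive_subgroup.a_inv_closed[OF is_additive_subgroup, of g]
    by (simp add: zpoly_ring_simps(2))
qed

text \<open>Congruence to a polynomial supported on \<open>B\<close> is preserved by differences, so it suffices to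
  treat terms; the terms outside \<open>B\<close> are handled by well-founded induction along \<open>r\<close>.\<close>

lemma normal_form_mod_ideal:
  assumes I: "ideal I (zpoly_ring n)"
    and "wf r"
    and step: "\<And>t. t \<in> exponents n \<Longrightarrow> t \<notin> B \<Longrightarrow>
      \<exists>f\<in>I. \<forall>s\<in>Poly_Mapping.keys (term_poly t - f). s \<in> exponents n \<and> (s, t) \<in> r"
    and p: "p \<in> carrier (zpoly_ring n)"
  shows "\<exists>g. Poly_Mapping.keys g \<subseteq> B \<and> p - g \<in> I"
proof -
  define reducible where "reducible p \<longleftrightarrow> (\<exists>g. Poly_Mapping.keys g \<subseteq> B \<and> p - g \<in> I)" for p
  have zero_I: "0 \<in> I"
    using additive_subgroup.zero_closed[OF ideal.axioms(1)[OF I]] by (simp add: zpoly_ring_simps)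
  have diff: "reducible (p - q)" if "reducible p" "reducible q" for p q
  proof -
    obtain g where g: "Poly_Mapping.keys g \<subseteq> B" "p - g \<in> I"
      using \<open>reducible p\<close> by (auto simp: reducible_def)
    obtain h where h: "Poly_Mapping.keys h \<subseteq> B" "q - h \<in> I"
      using \<open>reducible q\<close> by (auto simp: reducible_def)
    have "Poly_Mapping.keys (g - h) \<subseteq> B"
      using g(1) h(1) keys_diff[of g h] by blast
    moreover have "(p - q) - (g - h) \<in> I"
    proof -
      have "(p - q) - (g - h) = (p - g) - (q - h)"
        by simp
      with ideal_diff[OF I g(2) h(2)] show ?thesis
        by (simp only:)
    qed
    ultimately show ?thesis by (auto simp: reducible_def)
  qed
  have span: "reducible p" if "Poly_Mapping.keys p \<subseteq> S" "\<And>s. s \<in> S \<Longrightarrow> reducible (term_poly s)" for p S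
    using that(1)
  proof (induction p rule: frag_induction)
    case zero
    show ?case using zero_I unfolding reducible_def by (intro exI[of _ 0]) simp
  next
    case (one s)
    with that(2) show ?case by (simp add: term_poly_def)
  qed (rule diff)
  have "reducible (term_poly t)" if "t \<in> exponents n" for t
    using \<open>wf r\<close> that
  proof (induction t rule: wf_induct_rule)
    case (less t)
    show ?case
    proof (cases "t \<in> B")
      case True
      then show ?thesis
        using zero_I unfolding reducible_def term_poly_def by (intro exI[of _ "Poly_Mapping.single t 1"]) simp
    next
      case False
      with step less.prems obtain f where f: "f \<in> I"
        "\<forall>s\<in>Poly_Mapping.keys (term_poly t - f). s \<in> exponents n \<and> (s, t) \<in> r" by blast
      have "reducible (term_poly t - f)"
      proof (rule span[OF subset_refl])
        show "reducible (term_poly s)" if "s \<in> Poly_Mapping.keys (term_poly t - f)" for s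
          using less.IH f(2) that by blast
      qed
      moreover have "reducible (0 - f)"
        unfolding reducible_def using ideal_diff[OF I zero_I f(1)] by (intro exI[of _ 0]) simp
      ultimately have "reducible (term_poly t - f - (0 - f))" by (rule diff)
      then show ?thesis by simp
    qed
  qed
  then have "reducible p"
    using p by (intro span[of p "exponents n"]) (auto simp: zpoly_ring_simps)
  then show ?thesis
    by (simp add: reducible_def)
qed


section \<open>Generators of the quotient\<close>

lemma zpoly_ring_add_pow:
  assumes "t \<in> exponents n"
  shows "add_pow (zpoly_ring n) (k::int) (term_poly t) = Poly_Mapping.single t k"
proof -
  interpret P: cring "zpoly_ring n" by (rule zpoly_ring_cring)
  have t: "term_poly t \<in> carrier (zpoly_ring n)"
    using assms by (simp add: zpoly_ring_simps term_poly_def)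
  have nat: "add_pow (zpoly_ring n) (m::nat) (term_poly t) = Poly_Mapping.single t (int m)" for m
  proof (induction m)
    case 0
    show ?case by (simp add: add_pow_def flip: zpoly_ring_simps(3)[of n])
  next
    case (Suc m)
    then show ?case
      by (simp add: zpoly_ring_simps term_poly_def single_add)
  qed
  show ?thesis
  proof (cases "k \<ge> 0")
    case True
    then show ?thesis by (simp add: add_pow_int_ge nat)
  next
    case False
    have "Poly_Mapping.single t (int (nat (- k))) \<in> carrier (zpoly_ring n)"
      using assms by (simp add: zpoly_ring_simps)
    with False show ?thesis
      by (simp add: add_pow_int_lt nat zpoly_ring_a_inv single_uminus)
  qed
qed

lemma zpoly_ring_finsum:
  assumes "h \<in> A \<rightarrow> carrier (zpoly_ring n)"
  shows "finsum (zpoly_ring n) h A = sum h A"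
proof -
  interpret P: cring "zpoly_ring n" by (rule zpoly_ring_cring)
  show ?thesis
    using assms
  proof (induction A rule: infinite_finite_induct)
    case (insert a A)
    then have "finsum (zpoly_ring n) h (insert a A) = h a \<oplus>\<^bsub>zpoly_ring n\<^esub> finsum (zpoly_ring n) h A"
      by (intro P.finsum_insert) auto
    with insert show ?case by (simp add: zpoly_ring_simps)
  qed (simp_all add: zpoly_ring_simps)
qed

lemma coset_eq_finsum:
  assumes I: "ideal I (zpoly_ring n)" and g: "g \<in> carrier (zpoly_ring n)"
  shows "I +>\<^bsub>zpoly_ring n\<^esub> g = (\<Oplus>\<^bsub>zpoly_ring n Quot I\<^esub>t\<in>Poly_Mapping.keys g.
    add_pow (zpoly_ring n Quot I) (Poly_Mapping.lookup g t) (I +>\<^bsub>zpoly_ring n\<^esub> term_poly t))"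
proof -
  let ?P = "zpoly_ring n"
  interpret ideal I ?P by (rule I)
  interpret h: ring_hom_ring ?P "?P Quot I" "\<lambda>f. I +>\<^bsub>?P\<^esub> f"
    by (rule rcos_ring_hom_ring)
  have keys: "t \<in> exponents n" if "t \<in> Poly_Mapping.keys g" for t
    using g that by (auto simp: zpoly_ring_simps)
  have mono: "term_poly t \<in> carrier ?P" "Poly_Mapping.single t c \<in> carrier ?P"
    if "t \<in> Poly_Mapping.keys g" for t c
    using keys[OF that] by (auto simp: zpoly_ring_simps term_poly_def)
  have pow: "I +>\<^bsub>?P\<^esub> Poly_Mapping.single t k = add_pow (?P Quot I) k (I +>\<^bsub>?P\<^esub> term_poly t)"
    if "t \<in> Poly_Mapping.keys g" for t and k :: int
    using group_hom.hom_int_pow[OF h.a_group_hom, of "term_poly t" k] mono[OF that]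
      zpoly_ring_add_pow[OF keys[OF that], of k]
    by (simp add: add_pow_def)
  have "g = (\<Sum>t\<in>Poly_Mapping.keys g. Poly_Mapping.single t (Poly_Mapping.lookup g t))"
    by (rule poly_mapping_eqI) (simp add: lookup_sum lookup_single when_def in_keys_iff)
  also have "\<dots> = finsum ?P (\<lambda>t. Poly_Mapping.single t (Poly_Mapping.lookup g t)) (Poly_Mapping.keys g)"
    using mono by (subst zpoly_ring_finsum) auto
  finally have "I +>\<^bsub>?P\<^esub> g = I +>\<^bsub>?P\<^esub> \<dots>" by simp
  also have "\<dots> = (\<Oplus>\<^bsub>?P Quot I\<^esub>t\<in>Poly_Mapping.keys g.
      I +>\<^bsub>?P\<^esub> Poly_Mapping.single t (Poly_Mapping.lookup g t))"
    using mono by (subst h.hom_finsum) (auto simp: comp_def)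
  also have "\<dots> = (\<Oplus>\<^bsub>?P Quot I\<^esub>t\<in>Poly_Mapping.keys g.
      add_pow (?P Quot I) (Poly_Mapping.lookup g t) (I +>\<^bsub>?P\<^esub> term_poly t))"
    using mono by (intro h.S.finsum_cong') (auto simp flip: pow)
  finally show ?thesis .
qed

theorem proposition6p6:
  fixes n :: nat
    and I :: "zpoly set"
    and \<sigma> :: "(nat \<Rightarrow>\<^sub>0 nat) rel"
    and L :: "zpoly set"
  assumes "ideal I (zpoly_ring n)"
    and "finite_int_algebra (zpoly_ring n Quot I)"
    and "term_ordering n \<sigma>"
    and "L = {m \<in> LM_set \<sigma> I. LC \<sigma> m = 1}"
  shows "int_generating_set (zpoly_ring n Quot I)
           ((\<lambda>t. I +>\<^bsub>zpoly_ring n\<^esub> t) ` (terms n - L))"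
proof -
  let ?P = "zpoly_ring n"
  let ?cls = "\<lambda>t. I +>\<^bsub>?P\<^esub> term_poly t"
  note I = assms(1) and \<sigma> = assms(3)
  note lin = term_ordering_linear[OF \<sigma>]
  interpret Q: ring "?P Quot I" by (rule ideal.quotient_is_ring[OF I])
  note same_class = ring.quotient_eq_iff_same_a_r_cos[OF cring.axioms(1)[OF zpoly_ring_cring] I]
  define B where "B = {t \<in> exponents n. term_poly t \<notin> L}"
  have S: "(\<lambda>t. I +>\<^bsub>?P\<^esub> t) ` (terms n - L) = ?cls ` B"
    by (auto simp: terms_def B_def)
  have L_iff: "term_poly t \<in> L \<longleftrightarrow> (\<exists>f\<in>I - {0}. LT \<sigma> f = t \<and> LC \<sigma> f = 1)"
    if "t \<in> exponents n" for t
    using monic_leading_monomial_iff[OF \<sigma> _ that] ideal.Icarr[OF I] assms(4) by blast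
  have carr: "term_poly t \<in> carrier ?P" if "t \<in> exponents n" for t
    using that by (simp add: zpoly_ring_simps term_poly_def)
  have clsB: "?cls t \<in> carrier (?P Quot I)" if "t \<in> B" for t
    using ring_hom_closed[OF ideal.rcos_ring_hom[OF I] carr] that by (simp add: B_def)

  \<comment> \<open>As \<open>LC f = 1\<close>, subtracting \<open>f\<close> cancels \<open>t\<close> itself and leaves smaller terms.\<close>
  have reducible: "\<exists>f\<in>I. \<forall>s\<in>Poly_Mapping.keys (term_poly t - f). s \<in> exponents n \<and> (s, t) \<in> \<sigma> - Id"
    if t: "t \<in> exponents n" "t \<notin> B" for t
  proof -
    obtain f where f: "f \<in> I" "f \<noteq> 0" "LT \<sigma> f = t" "LC \<sigma> f = 1"
      using t L_iff by (auto simp: B_def)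
    have "s \<in> exponents n \<and> (s, t) \<in> \<sigma> - Id" if "s \<in> Poly_Mapping.keys (term_poly t - f)" for s
    proof -
      have "s \<noteq> t"
        using that f(3,4) by (auto simp: in_keys_iff lookup_minus LC_def term_poly_def)
      moreover from this have "s \<in> Poly_Mapping.keys f"
        using that by (auto simp: in_keys_iff lookup_minus lookup_single term_poly_def)
      then have "(s, t) \<in> \<sigma>"
        using LT_greatest[OF \<sigma> ideal.Icarr[OF I f(1)] f(2)] f(3) by blast
      ultimately show ?thesis using lin(1) by blast
    qed
    with f(1) show ?thesis by blast
  qed

  \<comment> \<open>Otherwise \<open>t - s\<close> would be an element of \<open>I\<close> with monic leading monomial \<open>t\<close>.\<close>
  have incongruent: "?cls s \<noteq> ?cls t" if st: "s \<in> B" "t \<in> B" "s \<noteq> t" "(s, t) \<in> \<sigma>" for s t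
  proof
    assume "?cls s = ?cls t"
    then have in_I: "term_poly t - term_poly s \<in> I"
      using st same_class[ of "term_poly t" "term_poly s"] carr
      by (auto simp: B_def zpoly_ring_a_minus)
    have keys: "Poly_Mapping.keys (term_poly t - term_poly s) = {s, t}"
      using st(3) by (auto simp: in_keys_iff lookup_minus lookup_single term_poly_def when_def split: if_splits)
    have "(t, t) \<in> \<sigma>"
      using lin(2) st(2) by (auto simp: B_def refl_on_def)
    then have LT: "LT \<sigma> (term_poly t - term_poly s) = t"
      using keys st(4) by (intro LT_eqI lin(4)) auto
    moreover have "LC \<sigma> (term_poly t - term_poly s) = 1"
      using LT st(3) by (simp add: LC_def lookup_minus lookup_single term_poly_def)
    moreover have "term_poly t - term_poly s \<noteq> 0"
      using keys by auto
    ultimately have "term_poly t \<in> L"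
      using in_I st(2) L_iff[of t] by (auto simp: B_def)
    with st(2) show False by (simp add: B_def)
  qed
  have inj: "inj_on ?cls B"
  proof (rule inj_onI, rule ccontr)
    fix s t assume st: "s \<in> B" "t \<in> B" "?cls s = ?cls t" "s \<noteq> t"
    then have "(s, t) \<in> \<sigma> \<or> (t, s) \<in> \<sigma>"
      using lin(5) by (auto simp: B_def total_on_def)
    with st incongruent[of s t] incongruent[of t s] show False by auto
  qed

  have "\<exists>T. \<exists>c :: zpoly set \<Rightarrow> int. finite T \<and> T \<subseteq> ?cls ` B \<and>
      x = (\<Oplus>\<^bsub>?P Quot I\<^esub>s\<in>T. add_pow (?P Quot I) (c s) s)"
    if x: "x \<in> carrier (?P Quot I)" for x
  proof -
    obtain p where p: "p \<in> carrier ?P" "x = I +>\<^bsub>?P\<^esub> p"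
      using x by (auto simp: FactRing_def A_RCOSETS_def')
    obtain g where g: "Poly_Mapping.keys g \<subseteq> B" "p - g \<in> I"
      using normal_form_mod_ideal[OF I wf_strict_term_ordering[OF \<sigma>] reducible p(1)] by blast
    have g_carr: "g \<in> carrier ?P"
      using g(1) by (auto simp: B_def zpoly_ring_simps)
    \<comment> \<open>Coefficients are indexed by classes, which determine their terms in \<open>B\<close>.\<close>
    define c where "c s = Poly_Mapping.lookup g (the_inv_into B ?cls s)" for s
    have c: "c (?cls t) = Poly_Mapping.lookup g t" if "t \<in> B" for t
      using the_inv_into_f_f[OF inj that] by (simp add: c_def)
    have "x = I +>\<^bsub>?P\<^esub> g"
      using p g(2) g_carr same_class[OF p(1) g_carr]
      by (simp add: zpoly_ring_a_minus)
    also have "\<dots> = (\<Oplus>\<^bsub>?P Quot I\<^esub>t\<in>Poly_Mapping.keys g.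
        add_pow (?P Quot I) (Poly_Mapping.lookup g t) (?cls t))"
      by (rule coset_eq_finsum[OF I g_carr])
    also have "\<dots> = (\<Oplus>\<^bsub>?P Quot I\<^esub>t\<in>Poly_Mapping.keys g.
        add_pow (?P Quot I) (c (?cls t)) (?cls t))"
      using g(1) clsB c by (intro Q.finsum_cong') (auto simp: subset_iff)
    also have "\<dots> = (\<Oplus>\<^bsub>?P Quot I\<^esub>s\<in>?cls ` Poly_Mapping.keys g. add_pow (?P Quot I) (c s) s)"
      using g(1) clsB by (intro Q.finsum_reindex[symmetric] inj_on_subset[OF inj]) auto
    finally show ?thesis
      using g(1) by (intro exI[of _ "?cls ` Poly_Mapping.keys g"] exI[of _ c]) auto
  qed
  then show ?thesis
    using clsB unfolding S int_generating_set_def by auto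
qed

end
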